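(* Let $(\mathcal{B},\mathcal{L},\theta,\mathcal{I}_\alpha)$ be a generalized Boolean dynamical system with associated transformation groupoid $\mathbb{F}\ltimes_\varphi\partial E$. For $(t,\mu)\in\mathbb{F}\ltimes_\varphi\partial E$ with $t\ne\emptyset$ and $\mu=(e^{\mu_i}_{\xi_i})$, we have $(t,\mu)\in\operatorname{Iso}(\mathbb{F}\ltimes_\varphi\partial E)$ if and only if there exist $\delta\in\mathcal{L}^*$ and $\gamma\in\mathcal{L}^{\geq1}$ such that $t=\delta\gamma\delta^{-1}$ or $t=\delta\gamma^{-1}\delta^{-1}$, $\mathcal{P}(\mu)=\delta\gamma^\infty$, and $e^{\gamma_1}_{\xi_{|\delta|+1}}\cdots e^{\gamma_{|\gamma|}}_{\xi_{|\delta|+|\gamma|}}$ is a loop at $d(e^{\delta_{|\delta|}}_{\xi_{|\delta|}})$ so that $$\mu=e^{\delta_1}_{\xi_1}\cdots e^{\delta_{|\delta|}}_{\xi_{|\delta|}}\bigl(e^{\gamma_1}_{\xi_{|\delta|+1}}\cdots e^{\gamma_{|\gamma|}}_{\xi_{|\delta|+|\gamma|}}\bigr)^\infty.$$ (When $\delta=\emptyset$, the vertex $d(e^{\delta_{|\delta|}}_{\xi_{|\delta|}})$ is read as $r(\mu)$.)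
   Context: Boolean dynamical systems. A Boolean algebra is a relatively complemented distributive lattice $\mathcal{B}$ with least element $\emptyset$ (no greatest element is required), with meet $\cap$, join $\cup$, relative complement $\setminus$ and order $A\subseteq B \iff A\cap B=A$. An ideal of $\mathcal{B}$ is a non-empty subset closed under finite unions and downward closed; it is again a Boolean algebra. A filter is a non-empty, down-directed, upward closed subset not containing $\emptyset$; an ultrafilter is a maximal filter; $\widehat{\mathcal{B}}$ is the set of ultrafilters of $\mathcal{B}$. An action on $\mathcal{B}$ is a map $\mathcal{B}\to\mathcal{B}$ preserving $\cap,\cup,\setminus$ and sending $\emptyset$ to $\emptyset$. For a set $\mathcal{L}$, $\mathcal{L}^{\geq 1}$ is the set of non-empty finite words, $\mathcal{L}^*=\mathcal{L}^{\ge1}\cup\{\emptyset\}$ ($\emptyset$ also denotes the empty word), $|\alpha|$ is the length of $\alpha$, and $\gamma^\infty$ is $\gamma$ concatenated infinitely many times. A Boolean dynamical system is a triple $(\mathcal{B},\mathcal{L},\theta)$ with $\{\theta_\alpha\}_{\alpha\in\mathcal{L}}$ a family of actions on $\mathcal{B}$; $\theta_{\alpha_1\cdots\alpha_n}=\theta_{\alpha_n}\circ\cdots\circ\theta_{\alpha_1}$, $\theta_\emptyset=\mathrm{Id}$. A generalized Boolean dynamical system $(\mathcal{B},\mathcal{L},\theta,\mathcal{I}_\alpha)$ is a Boolean dynamical system together with ideals $\mathcal{I}_\alpha\subseteq\mathcal{B}$ ($\alpha\in\mathcal{L}$) such that $\theta_\alpha(\mathcal{B})\subseteq\mathcal{I}_\alpha$.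 Put $\mathcal{I}_\emptyset=\mathcal{B}$ and, for $\alpha=\alpha_1\cdots\alpha_n$, $\mathcal{I}_\alpha=\{A\in\mathcal{B}: A\subseteq\theta_{\alpha_2\cdots\alpha_n}(B)\text{ for some }B\in\mathcal{I}_{\alpha_1}\}$. Boundary path space. $E^0=\widehat{\mathcal{B}}$ with basis of open sets $Z(A)=\{\xi\in\widehat{\mathcal{B}}:A\in\xi\}$, $A\in\mathcal{B}$. $F^0=E^0\cup\{\emptyset\}$, where $\emptyset$ (the empty subset of $\mathcal{B}$) is an isolated point if $\mathcal{B}$ has a greatest element, and otherwise is the point at infinity of the one-point compactification of $E^0$. For $\alpha\in\mathcal{L}$, $X_\alpha=\widehat{\mathcal{I}_\alpha}$ is the set of ultrafilters of $\mathcal{I}_\alpha$. $E^1=\{e^\alpha_\eta:\alpha\in\mathcal{L},\eta\in X_\alpha\}$ with the topology generated by the sets $Z^1(\alpha,B)=\{e^\alpha_\eta:\eta\in X_\alpha,\ B\in\eta\}$, $\alpha\in\mathcal{L}$, $B\in\mathcal{I}_\alpha$. Define $d:E^1\to E^0$, $d(e^\alpha_\eta)=\{C\in\mathcal{B}: C\supseteq A\text{ for some }A\in\eta\}$, and $r:E^1\to F^0$, $r(e^\alpha_\eta)=\{A\in\mathcal{B}:\theta_\alpha(A)\in\eta\}$. $E^n$ ($n\ge2$) is the set of $e_1\cdots e_n\in\prod_{i=1}^nE^1$ with $d(e_i)=r(e_{i+1})$ for $1\le i<n$, with the subspace topology; $E^*=\bigsqcup_{n\ge0}E^n$; $E^\infty$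 is the set of infinite sequences $(e_i)_{i\ge1}$ in $E^1$ with $d(e_i)=r(e_{i+1})$ for all $i$. For $\mu=e_1\cdots e_n\in E^n$, $d(\mu)=d(e_n)$, $r(\mu)=r(e_1)$; for $\xi\in E^0$, $d(\xi)=r(\xi)=\xi$; for an infinite path, $r(\mu)=r(e_1)$. $|\mu|$ is the length, and $\mu_{[i,j]}$ is the sub-path from the $i$-th to the $j$-th edge. A loop is a path $\mu\in E^*\setminus E^0$ with $r(\mu)=d(\mu)$; it is a loop at (with base point) $r(\mu)$. Let $F^0_{sce}=F^0\setminus\overline{r(E^1)}$, $F^0_{fin}=\{v\in F^0: v\text{ has a neighborhood }V\text{ with }r^{-1}(V)\text{ compact}\}$, $F^0_{rg}=F^0_{fin}\setminus\overline{F^0_{sce}}$, $F^0_{sg}=F^0\setminus F^0_{rg}$, $E^0_{sg}=F^0_{sg}\cap E^0$. The boundary path space is $\partial E=E^\infty\sqcup\{\mu\in E^*:d(\mu)\in E^0_{sg}\}$. For $\mu=(e^{\mu_k}_{\xi_k})_k\in\partial E$, $\mathcal{P}(\mu)$ is the (finite or infinite) word $(\mu_k)_k$, and $\mathcal{P}(\eta)=\emptyset$ for $\eta\in E^0$. Partial action. $\mathcal{W}^*=\{\alpha\in\mathcal{L}^*:\mathcal{I}_\alpha\neq\{\emptyset\}\}$. $\mathbb{F}$ is the free group generated by $\mathcal{L}$, with identity denoted $\emptyset$. Put $U_\emptyset=\partial E$. For $\alpha,\beta\in\mathcal{W}^*$ with $\alpha\beta^{-1}$ in reduced form and $\mathcal{I}_\alpha\cap\mathcal{I}_\beta\ne\{\emptyset\}$: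 $U_{\alpha\beta^{-1}}=\{(e^{\mu_k}_{\eta_k})_{k}\in\partial E:\mu_1\cdots\mu_{|\alpha|}=\alpha,\ \eta_{|\alpha|}\cap\mathcal{I}_\beta\ne\emptyset\}$ if $\alpha\ne\emptyset$ (so $U_\alpha$ is the set of boundary paths whose label word begins with $\alpha$), and $U_{\beta^{-1}}=\{\mu\in\partial E:r(\mu)\cap\mathcal{I}_\beta\neq\emptyset\}$. For all other $t\in\mathbb{F}$, $U_t=\emptyset$. $\varphi_\emptyset$ is the identity. For $\alpha,\beta\in\mathcal{W}^*$ with $\alpha\beta^{-1}$ reduced and $U_{\beta\alpha^{-1}}\ne\emptyset$, $\varphi_{\alpha\beta^{-1}}:U_{\beta\alpha^{-1}}\to U_{\alpha\beta^{-1}}$ is $\varphi_{\alpha\beta^{-1}}(\mu)=e^{\alpha_1}_{\eta_1}\cdots e^{\alpha_n}_{\eta_n}\mu_{[|\beta|+1,|\mu|]}$, where $n=|\alpha|$, $\eta_n=v\cap\mathcal{I}_{\alpha_n}$ with $v=d(\mu_{[1,|\beta|]})$ (and $v=r(\mu)$ if $\beta=\emptyset$), and $\eta_{i}=\{A\in\mathcal{B}:\theta_{\alpha_{i+1}}(A)\in\eta_{i+1}\}\cap\mathcal{I}_{\alpha_{i}}$ for $i=n-1,\dots,1$ (if $\alpha=\emptyset$ the edges $e^{\alpha_i}_{\eta_i}$ are absent, and if moreover $|\mu|=|\beta|$ the result is the vertex $d(\mu)$). For all other $t$, $\varphi_t$ is the empty map. Groupoid. $\mathbb{F}\ltimes_\varphi\partial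 E=\{(t,\mu)\in\mathbb{F}\times\partial E:\mu\in U_t\}$, with $(t,\mu)(s,\nu)=(ts,\mu)$ if $\varphi_{t^{-1}}(\mu)=\nu$, $(t,\mu)^{-1}=(t^{-1},\varphi_{t^{-1}}(\mu))$, range $\mu$ and source $\varphi_{t^{-1}}(\mu)$. Its isotropy group bundle is $\operatorname{Iso}(\mathbb{F}\ltimes_\varphi\partial E)=\{(t,\mu):\varphi_{t^{-1}}(\mu)=\mu\}$. *)

theory Defs
  imports
    "HOL-Analysis.Analysis"
    "HOL-Algebra.Group"
    "HOL-Library.Omega_Words_Fun"
begin

section \<open>Generalized Boolean dynamical systems\<close>

text \<open>
  Relatively complemented distributive lattices with a least element and not necessarily a
  greatest one: \<open>A - B\<close> is the complement of \<open>inf A B\<close> in the interval from \<open>bot\<close> to \<open>A\<close>.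
\<close>

class generalized_boolean_algebra = distrib_lattice + bounded_lattice_bot + minus +
  assumes inf_diff_inf: "inf (A - B) (inf A B) = bot"
    and sup_diff_inf: "sup (A - B) (inf A B) = A"

definition boolean_ideal :: "'a::generalized_boolean_algebra set \<Rightarrow> bool" where
  "boolean_ideal I \<longleftrightarrow>
     I \<noteq> {} \<and> (\<forall>A\<in>I. \<forall>B\<in>I. sup A B \<in> I) \<and> (\<forall>A\<in>I. \<forall>B. B \<le> A \<longrightarrow> B \<in> I)"

text \<open>Filters and ultrafilters of an ideal \<open>I\<close>, regarded as a Boolean algebra in its own right.\<close>

definition filter_in :: "'a::generalized_boolean_algebra set \<Rightarrow> 'a set \<Rightarrow> bool" where
  "filter_in I F \<longleftrightarrow>
     F \<subseteq> I \<and> F \<noteq> {} \<and> bot \<notin> F \<and>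
     (\<forall>A\<in>F. \<forall>B\<in>F. \<exists>C\<in>F. C \<le> A \<and> C \<le> B) \<and>
     (\<forall>A\<in>F. \<forall>B\<in>I. A \<le> B \<longrightarrow> B \<in> F)"

definition ultrafilters :: "'a::generalized_boolean_algebra set \<Rightarrow> 'a set set" where
  "ultrafilters I = {F. filter_in I F \<and> (\<forall>G. filter_in I G \<and> F \<subseteq> G \<longrightarrow> G = F)}"

definition boolean_action :: "('a::generalized_boolean_algebra \<Rightarrow> 'a) \<Rightarrow> bool" where
  "boolean_action f \<longleftrightarrow>
     (\<forall>A B. f (inf A B) = inf (f A) (f B)) \<and> (\<forall>A B. f (sup A B) = sup (f A) (f B)) \<and>
     (\<forall>A B. f (A - B) = f A - f B) \<and> f bot = bot"

definition generalized_BDS ::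
  "('l \<Rightarrow> 'a::generalized_boolean_algebra \<Rightarrow> 'a) \<Rightarrow> ('l \<Rightarrow> 'a set) \<Rightarrow> bool" where
  "generalized_BDS \<theta> I \<longleftrightarrow>
     (\<forall>a. boolean_action (\<theta> a)) \<and> (\<forall>a. boolean_ideal (I a)) \<and> (\<forall>a. range (\<theta> a) \<subseteq> I a)"

text \<open>The leftmost letter acts first: the composite is \<open>\<theta> a\<^sub>n \<circ> \<dots> \<circ> \<theta> a\<^sub>1\<close>.\<close>

definition word_action :: "('l \<Rightarrow> 'a \<Rightarrow> 'a) \<Rightarrow> 'l list \<Rightarrow> 'a \<Rightarrow> 'a" where
  "word_action \<theta> \<alpha> = fold \<theta> \<alpha>"

fun word_ideal ::
  "('l \<Rightarrow> 'a::generalized_boolean_algebra \<Rightarrow> 'a) \<Rightarrow> ('l \<Rightarrow> 'a set) \<Rightarrow> 'l list \<Rightarrow> 'a set" where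
  "word_ideal \<theta> I [] = UNIV"
| "word_ideal \<theta> I (a # \<alpha>) = {A. \<exists>B\<in>I a. A \<le> word_action \<theta> \<alpha> B}"

definition W_star ::
  "('l \<Rightarrow> 'a::generalized_boolean_algebra \<Rightarrow> 'a) \<Rightarrow> ('l \<Rightarrow> 'a set) \<Rightarrow> 'l list set" where
  "W_star \<theta> I = {\<alpha>. word_ideal \<theta> I \<alpha> \<noteq> {bot}}"


section \<open>The topological correspondence\<close>

definition E0 :: "'a::generalized_boolean_algebra set set" where
  "E0 = ultrafilters UNIV"

definition E0_top :: "'a::generalized_boolean_algebra set topology" where
  "E0_top = topology_generated_by {{\<xi>\<in>E0. A \<in> \<xi>} | A. True}"

definition F0 :: "'a::generalized_boolean_algebra set set" where
  "F0 = insert {} E0"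

text \<open>
  In the second case the one-point compactification of the library, whose point at infinity is
  \<open>None\<close>, is transported along the bijection sending the empty set to \<open>None\<close>.
\<close>

definition F0_top :: "'a::generalized_boolean_algebra set topology" where
  "F0_top =
     (if \<exists>T::'a. \<forall>A. A \<le> T
      then topology_generated_by (insert {{}} {{\<xi>\<in>E0. A \<in> \<xi>} | A. True})
      else pullback_topology F0 (\<lambda>\<xi>. if \<xi> = {} then None else Some \<xi>)
             (Alexandroff_compactification E0_top))"

text \<open>The edge with label \<open>a\<close> and ultrafilter \<open>\<eta>\<close> is the pair \<open>(a, \<eta>)\<close>.\<close>

type_synonym ('l, 'a) edge = "'l \<times> 'a set"

definition E1 :: "('l \<Rightarrow> 'a::generalized_boolean_algebra set) \<Rightarrow> ('l, 'a) edge set" where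
  "E1 I = {(a, \<eta>) | a \<eta>. \<eta> \<in> ultrafilters (I a)}"

definition E1_top :: "('l \<Rightarrow> 'a::generalized_boolean_algebra set) \<Rightarrow> ('l, 'a) edge topology" where
  "E1_top I =
     topology_generated_by {{(a, \<eta>) | \<eta>. \<eta> \<in> ultrafilters (I a) \<and> B \<in> \<eta>} | a B. B \<in> I a}"

definition edge_dom :: "('l, 'a::generalized_boolean_algebra) edge \<Rightarrow> 'a set" where
  "edge_dom e = {C. \<exists>A\<in>snd e. A \<le> C}"

definition edge_rng ::
  "('l \<Rightarrow> 'a \<Rightarrow> 'a) \<Rightarrow> ('l, 'a::generalized_boolean_algebra) edge \<Rightarrow> 'a set" where
  "edge_rng \<theta> e = {A. \<theta> (fst e) A \<in> snd e}"

definition F0_sce ::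
  "('l \<Rightarrow> 'a::generalized_boolean_algebra \<Rightarrow> 'a) \<Rightarrow> ('l \<Rightarrow> 'a set) \<Rightarrow> 'a set set" where
  "F0_sce \<theta> I = F0 - F0_top closure_of (edge_rng \<theta> ` E1 I)"

definition F0_fin ::
  "('l \<Rightarrow> 'a::generalized_boolean_algebra \<Rightarrow> 'a) \<Rightarrow> ('l \<Rightarrow> 'a set) \<Rightarrow> 'a set set" where
  "F0_fin \<theta> I =
     {v\<in>F0. \<exists>V\<subseteq>F0. (\<exists>W. openin F0_top W \<and> v \<in> W \<and> W \<subseteq> V) \<and>
                   compactin (E1_top I) {e\<in>E1 I. edge_rng \<theta> e \<in> V}}"

definition F0_rg ::
  "('l \<Rightarrow> 'a::generalized_boolean_algebra \<Rightarrow> 'a) \<Rightarrow> ('l \<Rightarrow> 'a set) \<Rightarrow> 'a set set" where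
  "F0_rg \<theta> I = F0_fin \<theta> I - F0_top closure_of (F0_sce \<theta> I)"

definition F0_sg ::
  "('l \<Rightarrow> 'a::generalized_boolean_algebra \<Rightarrow> 'a) \<Rightarrow> ('l \<Rightarrow> 'a set) \<Rightarrow> 'a set set" where
  "F0_sg \<theta> I = F0 - F0_rg \<theta> I"

definition E0_sg ::
  "('l \<Rightarrow> 'a::generalized_boolean_algebra \<Rightarrow> 'a) \<Rightarrow> ('l \<Rightarrow> 'a set) \<Rightarrow> 'a set set" where
  "E0_sg \<theta> I = F0_sg \<theta> I \<inter> E0"


section \<open>Finite and infinite words, and paths\<close>

text \<open>All positions in words and paths are counted from 0.\<close>

datatype 'x fin_inf_word = FinW "'x list" | InfW "nat \<Rightarrow> 'x"

primrec word_nth :: "'x fin_inf_word \<Rightarrow> nat \<Rightarrow> 'x" where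
  "word_nth (FinW xs) i = xs ! i"
| "word_nth (InfW f) i = f i"

primrec word_take :: "nat \<Rightarrow> 'x fin_inf_word \<Rightarrow> 'x list" where
  "word_take n (FinW xs) = take n xs"
| "word_take n (InfW f) = map f [0..<n]"

primrec word_drop :: "nat \<Rightarrow> 'x fin_inf_word \<Rightarrow> 'x fin_inf_word" where
  "word_drop n (FinW xs) = FinW (drop n xs)"
| "word_drop n (InfW f) = InfW (\<lambda>i. f (n + i))"

primrec word_append :: "'x list \<Rightarrow> 'x fin_inf_word \<Rightarrow> 'x fin_inf_word" where
  "word_append ys (FinW xs) = FinW (ys @ xs)"
| "word_append ys (InfW f) = InfW (ys \<frown> f)"

text \<open>Paths of length 0 are vertices; paths of positive length are nonempty words of edges.\<close>

datatype ('l, 'a) path = Vertex "'a set" | Edges "('l, 'a) edge fin_inf_word"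

primrec path_edges :: "('l, 'a) path \<Rightarrow> ('l, 'a) edge fin_inf_word" where
  "path_edges (Vertex v) = FinW []"
| "path_edges (Edges w) = w"

fun path_rng ::
  "('l \<Rightarrow> 'a \<Rightarrow> 'a) \<Rightarrow> ('l, 'a::generalized_boolean_algebra) path \<Rightarrow> 'a set" where
  "path_rng \<theta> (Vertex v) = v"
| "path_rng \<theta> (Edges w) = edge_rng \<theta> (word_nth w 0)"

text \<open>Only meaningful for finite paths.\<close>

fun path_dom :: "('l, 'a::generalized_boolean_algebra) path \<Rightarrow> 'a set" where
  "path_dom (Vertex v) = v"
| "path_dom (Edges (FinW es)) = edge_dom (last es)"
| "path_dom (Edges (InfW e)) = undefined"

definition finite_paths_of_length ::
  "('l \<Rightarrow> 'a::generalized_boolean_algebra \<Rightarrow> 'a) \<Rightarrow> ('l \<Rightarrow> 'a set) \<Rightarrow> nat \<Rightarrow> ('l, 'a) path set" where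
  "finite_paths_of_length \<theta> I n =
     (if n = 0 then Vertex ` E0
      else {Edges (FinW es) | es. length es = n \<and> set es \<subseteq> E1 I \<and>
              (\<forall>i. Suc i < n \<longrightarrow> edge_dom (es ! i) = edge_rng \<theta> (es ! Suc i))})"

definition finite_paths ::
  "('l \<Rightarrow> 'a::generalized_boolean_algebra \<Rightarrow> 'a) \<Rightarrow> ('l \<Rightarrow> 'a set) \<Rightarrow> ('l, 'a) path set" where
  "finite_paths \<theta> I = (\<Union>n. finite_paths_of_length \<theta> I n)"

definition infinite_paths ::
  "('l \<Rightarrow> 'a::generalized_boolean_algebra \<Rightarrow> 'a) \<Rightarrow> ('l \<Rightarrow> 'a set) \<Rightarrow> ('l, 'a) path set" where
  "infinite_paths \<theta> I =
     {Edges (InfW e) | e. (\<forall>i. e i \<in> E1 I) \<and> (\<forall>i. edge_dom (e i) = edge_rng \<theta> (e (Suc i)))}"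

definition boundary_paths ::
  "('l \<Rightarrow> 'a::generalized_boolean_algebra \<Rightarrow> 'a) \<Rightarrow> ('l \<Rightarrow> 'a set) \<Rightarrow> ('l, 'a) path set" where
  "boundary_paths \<theta> I = infinite_paths \<theta> I \<union> {\<mu>\<in>finite_paths \<theta> I. path_dom \<mu> \<in> E0_sg \<theta> I}"

definition loop_at ::
  "('l \<Rightarrow> 'a::generalized_boolean_algebra \<Rightarrow> 'a) \<Rightarrow> ('l \<Rightarrow> 'a set) \<Rightarrow> ('l, 'a) path \<Rightarrow> 'a set \<Rightarrow> bool"
  where
  "loop_at \<theta> I \<mu> v \<longleftrightarrow>
     \<mu> \<in> finite_paths \<theta> I - finite_paths_of_length \<theta> I 0 \<and> path_rng \<theta> \<mu> = path_dom \<mu> \<and>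
     v = path_rng \<theta> \<mu>"

definition label_word :: "('l, 'a) path \<Rightarrow> 'l fin_inf_word" where
  "label_word \<mu> = map_fin_inf_word fst (path_edges \<mu>)"

definition path_filter :: "('l, 'a) path \<Rightarrow> nat \<Rightarrow> 'a set" where
  "path_filter \<mu> i = snd (word_nth (path_edges \<mu>) i)"

text \<open>The edge word with labels \<open>\<alpha>\<close> and ultrafilters \<open>\<zeta> 0, \<dots>, \<zeta> (length \<alpha> - 1)\<close>.\<close>

definition edge_list :: "'l list \<Rightarrow> (nat \<Rightarrow> 'a set) \<Rightarrow> ('l, 'a) edge list" where
  "edge_list \<alpha> \<zeta> = map (\<lambda>i. (\<alpha> ! i, \<zeta> i)) [0..<length \<alpha>]"


section \<open>The free group\<close>

text \<open>
  Elements are the reduced words in signed letters; \<open>(a, True)\<close> stands for the generator \<open>a\<close>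
  and \<open>(a, False)\<close> for its inverse.
\<close>

type_synonym 'l signed_word = "('l \<times> bool) list"

definition flip_sign :: "'l \<times> bool \<Rightarrow> 'l \<times> bool" where
  "flip_sign x = (fst x, \<not> snd x)"

definition reduced_word :: "'l signed_word \<Rightarrow> bool" where
  "reduced_word w \<longleftrightarrow> (\<forall>i. Suc i < length w \<longrightarrow> w ! Suc i \<noteq> flip_sign (w ! i))"

fun cons_reduce :: "'l \<times> bool \<Rightarrow> 'l signed_word \<Rightarrow> 'l signed_word" where
  "cons_reduce x [] = [x]"
| "cons_reduce x (y # w) = (if y = flip_sign x then w else x # y # w)"

definition free_group :: "'l signed_word monoid" where
  "free_group =
     \<lparr>carrier = {w. reduced_word w}, mult = (\<lambda>u v. foldr cons_reduce u v), one = []\<rparr>"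

definition pos_word :: "'l list \<Rightarrow> 'l signed_word" where
  "pos_word \<alpha> = map (\<lambda>a. (a, True)) \<alpha>"

definition formal_inverse :: "'l signed_word \<Rightarrow> 'l signed_word" where
  "formal_inverse w = rev (map flip_sign w)"

lemma flip_flip [simp]: "flip_sign (flip_sign x) = x"
  by (simp add: flip_sign_def)

lemma flip_sign_neq [simp]: "flip_sign x \<noteq> x" "x \<noteq> flip_sign x"
  by (simp_all add: flip_sign_def prod_eq_iff)

lemma reduced_Nil [simp]: "reduced_word []"
  by (simp add: reduced_word_def)

lemma reduced_single [simp]: "reduced_word [x]"
  by (simp add: reduced_word_def)

lemma reduced_Cons_Cons [simp]:
  "reduced_word (x # y # w) \<longleftrightarrow> y \<noteq> flip_sign x \<and> reduced_word (y # w)"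
proof -
  have "(\<forall>i. P i) \<longleftrightarrow> P 0 \<and> (\<forall>i. P (Suc i))" for P :: "nat \<Rightarrow> bool"
    by (metis not0_implies_Suc)
  from this[of "\<lambda>i. Suc i < length (x # y # w) \<longrightarrow> (x # y # w) ! Suc i \<noteq> flip_sign ((x # y # w) ! i)"]
  show ?thesis
    by (simp add: reduced_word_def)
qed

lemma reduced_ConsD: "reduced_word (x # w) \<Longrightarrow> reduced_word w"
  by (cases w) auto

lemma reduced_cons_reduce: "reduced_word w \<Longrightarrow> reduced_word (cons_reduce x w)"
  by (cases w) (auto dest: reduced_ConsD)

lemma reduced_foldr: "reduced_word w \<Longrightarrow> reduced_word (foldr cons_reduce u w)"
  by (induction u) (auto intro: reduced_cons_reduce)

lemma cons_reduce_flip: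
  assumes "reduced_word w"
  shows "cons_reduce (flip_sign x) (cons_reduce x w) = w"
proof (cases w)
  case (Cons y v)
  show ?thesis
  proof (cases "y = flip_sign x")
    case True
    with Cons assms show ?thesis by (cases v) auto
  next
    case False
    with Cons show ?thesis by simp
  qed
qed simp

lemma foldr_cons_reduce:
  assumes "reduced_word w"
  shows "foldr cons_reduce (cons_reduce x u) w = cons_reduce x (foldr cons_reduce u w)"
proof (cases u)
  case (Cons y v)
  have "cons_reduce x (cons_reduce (flip_sign x) (foldr cons_reduce v w)) = foldr cons_reduce v w"
    using cons_reduce_flip[of "foldr cons_reduce v w" "flip_sign x"] assms
    by (simp add: reduced_foldr)
  with Cons show ?thesis by auto
qed simp

lemma free_mult_assoc:
  assumes "reduced_word w"
  shows "foldr cons_reduce (foldr cons_reduce u v) w = foldr cons_reduce u (foldr cons_reduce v w)"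
  by (induction u) (auto simp: foldr_cons_reduce assms)

lemma foldr_reduced_Nil: "reduced_word w \<Longrightarrow> foldr cons_reduce w [] = w"
proof (induction w)
  case (Cons x w)
  then show ?case by (cases w) auto
qed simp

lemma formal_inverse_cancel:
  "reduced_word v \<Longrightarrow> foldr cons_reduce (formal_inverse w) (foldr cons_reduce w v) = v"
  by (induction w) (auto simp: formal_inverse_def cons_reduce_flip reduced_foldr)

lemma reduced_append_single:
  "reduced_word (w @ [x]) \<longleftrightarrow> reduced_word w \<and> (w \<noteq> [] \<longrightarrow> x \<noteq> flip_sign (last w))"
proof (induction w)
  case (Cons y w)
  then show ?case by (cases w) auto
qed simp

lemma reduced_formal_inverse: "reduced_word w \<Longrightarrow> reduced_word (formal_inverse w)"
proof (induction w)
  case (Cons x w)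
  have "reduced_word (formal_inverse w)"
    using Cons reduced_ConsD by blast
  moreover have "flip_sign x \<noteq> flip_sign (last (formal_inverse w))" if "w \<noteq> []"
    using that Cons.prems
    by (cases w) (auto simp: formal_inverse_def dest: arg_cong[of _ _ flip_sign])
  moreover have "formal_inverse (x # w) = formal_inverse w @ [flip_sign x]"
    by (simp add: formal_inverse_def)
  ultimately show ?case
    by (auto simp: reduced_append_single) (simp add: formal_inverse_def)
qed (simp add: formal_inverse_def)

lemma group_free_group: "group free_group"
proof (rule groupI)
  fix w :: "'l signed_word"
  assume w: "w \<in> carrier free_group"
  then have "formal_inverse w \<otimes>\<^bsub>free_group\<^esub> w = \<one>\<^bsub>free_group\<^esub>"
    using formal_inverse_cancel[of "[]" w]
    by (simp add: free_group_def foldr_reduced_Nil)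
  with w show "\<exists>u\<in>carrier free_group. u \<otimes>\<^bsub>free_group\<^esub> w = \<one>\<^bsub>free_group\<^esub>"
    by (auto simp: free_group_def intro: reduced_formal_inverse)
qed (auto simp: free_group_def reduced_foldr free_mult_assoc)

lemma inv_free_group:
  assumes "w \<in> carrier free_group"
  shows "inv\<^bsub>free_group\<^esub> w = formal_inverse w"
proof (rule group.inv_equality[OF group_free_group])
  show "formal_inverse w \<otimes>\<^bsub>free_group\<^esub> w = \<one>\<^bsub>free_group\<^esub>"
    using assms formal_inverse_cancel[of "[]" w]
    by (simp add: free_group_def foldr_reduced_Nil)
qed (use assms in \<open>auto simp: free_group_def intro: reduced_formal_inverse\<close>)


section \<open>The partial action on the boundary path space\<close>

text \<open>The word \<open>\<alpha>\<beta>\<^sup>-\<^sup>1\<close> is in reduced form and represents \<open>t\<close>.\<close>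

definition reduced_form :: "'l signed_word \<Rightarrow> 'l list \<Rightarrow> 'l list \<Rightarrow> bool" where
  "reduced_form t \<alpha> \<beta> \<longleftrightarrow>
     t = pos_word \<alpha> @ formal_inverse (pos_word \<beta>) \<and> reduced_word t"

definition U_pair ::
  "('l \<Rightarrow> 'a::generalized_boolean_algebra \<Rightarrow> 'a) \<Rightarrow> ('l \<Rightarrow> 'a set) \<Rightarrow>
   'l list \<Rightarrow> 'l list \<Rightarrow> ('l, 'a) path set" where
  "U_pair \<theta> I \<alpha> \<beta> =
     (if \<alpha> = [] then {\<mu>\<in>boundary_paths \<theta> I. path_rng \<theta> \<mu> \<inter> word_ideal \<theta> I \<beta> \<noteq> {}}
      else {\<mu>\<in>boundary_paths \<theta> I. word_take (length \<alpha>) (label_word \<mu>) = \<alpha> \<and>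
              path_filter \<mu> (length \<alpha> - 1) \<inter> word_ideal \<theta> I \<beta> \<noteq> {}})"

text \<open>
  For \<open>t \<noteq> 1\<close> the union below has at most one member, since \<open>t\<close> determines \<open>\<alpha>\<close> and \<open>\<beta>\<close>; it is
  empty if \<open>t\<close> is not of the required form.
\<close>

definition U_dom ::
  "('l \<Rightarrow> 'a::generalized_boolean_algebra \<Rightarrow> 'a) \<Rightarrow> ('l \<Rightarrow> 'a set) \<Rightarrow>
   'l signed_word \<Rightarrow> ('l, 'a) path set" where
  "U_dom \<theta> I t =
     (if t = \<one>\<^bsub>free_group\<^esub> then boundary_paths \<theta> I
      else \<Union>{U_pair \<theta> I \<alpha> \<beta> | \<alpha> \<beta>. reduced_form t \<alpha> \<beta> \<and> \<alpha> \<in> W_star \<theta> I \<and> \<beta> \<in> W_star \<theta> I \<and>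
                word_ideal \<theta> I \<alpha> \<inter> word_ideal \<theta> I \<beta> \<noteq> {bot}})"

text \<open>The edges with labels \<open>\<alpha>\<close> obtained by moving backwards from the vertex \<open>v\<close>.\<close>

fun edges_into ::
  "('l \<Rightarrow> 'a::generalized_boolean_algebra \<Rightarrow> 'a) \<Rightarrow> ('l \<Rightarrow> 'a set) \<Rightarrow>
   'l list \<Rightarrow> 'a set \<Rightarrow> ('l, 'a) edge list" where
  "edges_into \<theta> I [] v = []"
| "edges_into \<theta> I [a] v = [(a, v \<inter> I a)]"
| "edges_into \<theta> I (a # b # \<alpha>) v =
     (let es = edges_into \<theta> I (b # \<alpha>) v in (a, {A. \<theta> b A \<in> snd (hd es)} \<inter> I a) # es)"

text \<open>
  The vertex in which the initial segment of \<open>\<mu>\<close> of length \<open>n\<close> ends.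
\<close>

definition vertex_after ::
  "('l \<Rightarrow> 'a::generalized_boolean_algebra \<Rightarrow> 'a) \<Rightarrow> ('l, 'a) path \<Rightarrow> nat \<Rightarrow> 'a set" where
  "vertex_after \<theta> \<mu> n =
     (if n = 0 then path_rng \<theta> \<mu> else edge_dom (word_nth (path_edges \<mu>) (n - 1)))"

text \<open>
  The last case split concerns \<open>\<alpha> = []\<close> and \<open>\<mu>\<close> of length \<open>length \<beta>\<close>, where \<open>v\<close> is the domain
  of \<open>\<mu>\<close>.
\<close>

definition phi_pair ::
  "('l \<Rightarrow> 'a::generalized_boolean_algebra \<Rightarrow> 'a) \<Rightarrow> ('l \<Rightarrow> 'a set) \<Rightarrow>
   'l list \<Rightarrow> 'l list \<Rightarrow> ('l, 'a) path \<Rightarrow> ('l, 'a) path" where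
  "phi_pair \<theta> I \<alpha> \<beta> \<mu> =
     (let v = vertex_after \<theta> \<mu> (length \<beta>);
          w = word_append (edges_into \<theta> I \<alpha> v) (word_drop (length \<beta>) (path_edges \<mu>))
      in if w = FinW [] then Vertex v else Edges w)"

text \<open>The partial map from \<open>U_dom \<theta> I (inv t)\<close> to \<open>U_dom \<theta> I t\<close>, \<open>undefined\<close> off its domain.\<close>

definition phi ::
  "('l \<Rightarrow> 'a::generalized_boolean_algebra \<Rightarrow> 'a) \<Rightarrow> ('l \<Rightarrow> 'a set) \<Rightarrow>
   'l signed_word \<Rightarrow> ('l, 'a) path \<Rightarrow> ('l, 'a) path" where
  "phi \<theta> I t =
     restrict
       (if t = \<one>\<^bsub>free_group\<^esub> then (\<lambda>\<mu>. \<mu>)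
        else case (THE (\<alpha>, \<beta>). reduced_form t \<alpha> \<beta>) of (\<alpha>, \<beta>) \<Rightarrow> phi_pair \<theta> I \<alpha> \<beta>)
       (U_dom \<theta> I (inv\<^bsub>free_group\<^esub> t))"


section \<open>The transformation groupoid\<close>

text \<open>The product \<open>g_mult G g h\<close> is only meaningful if \<open>g_src G g = g_rng G h\<close>.\<close>

record ('g, 'x) groupoid_data =
  arrows :: "'g set"
  g_rng :: "'g \<Rightarrow> 'x"
  g_src :: "'g \<Rightarrow> 'x"
  g_mult :: "'g \<Rightarrow> 'g \<Rightarrow> 'g"
  g_inv :: "'g \<Rightarrow> 'g"

definition isotropy :: "('g, 'x) groupoid_data \<Rightarrow> 'g set" where
  "isotropy G = {g\<in>arrows G. g_src G g = g_rng G g}"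

definition transformation_groupoid ::
  "('l \<Rightarrow> 'a::generalized_boolean_algebra \<Rightarrow> 'a) \<Rightarrow> ('l \<Rightarrow> 'a set) \<Rightarrow>
   ('l signed_word \<times> ('l, 'a) path, ('l, 'a) path) groupoid_data" where
  "transformation_groupoid \<theta> I =
     \<lparr>arrows = {(t, \<mu>). t \<in> carrier free_group \<and> \<mu> \<in> boundary_paths \<theta> I \<and> \<mu> \<in> U_dom \<theta> I t},
      g_rng = (\<lambda>(t, \<mu>). \<mu>),
      g_src = (\<lambda>(t, \<mu>). phi \<theta> I (inv\<^bsub>free_group\<^esub> t) \<mu>),
      g_mult = (\<lambda>(t, \<mu>) (s, \<nu>). (t \<otimes>\<^bsub>free_group\<^esub> s, \<mu>)),
      g_inv = (\<lambda>(t, \<mu>). (inv\<^bsub>free_group\<^esub> t, phi \<theta> I (inv\<^bsub>free_group\<^esub> t) \<mu>))\<rparr>"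

end

theory Submission
  imports Defs
begin

text \<open>
  Write \<open>t = \<alpha>\<beta>\<^sup>-\<^sup>1\<close> in reduced form. The arrow \<open>(t, \<mu>)\<close> lies in the isotropy iff replacing the
  initial segment of \<open>\<mu>\<close> with label word \<open>\<alpha>\<close> by the edges labelled \<open>\<beta>\<close> that lead to the same
  vertex gives \<open>\<mu>\<close> back. If \<open>\<mu>\<close> is finite, comparing lengths gives \<open>|\<alpha>| = |\<beta>|\<close> and comparing
  labels gives \<open>\<alpha> = \<beta>\<close>, hence \<open>t = 1\<close> (\<open>fixed_finite_path_words_eq\<close>); so only infinite paths
  matter.

  The decisive property of the edges is that an edge is determined by its label and its domain
  (\<open>edge_eq_label_dom\<close>). In a path the domain of an edge is the range of the next one, so a finite
  piece of a path is determined by its labels and the vertex in which it ends. Consequently the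
  inserted edges are automatically the first edges of \<open>\<mu>\<close> once the labels and the end vertex are
  right, and \<open>\<mu>\<close> is fixed iff its labels begin with \<open>\<beta>\<close> and its tails after \<open>|\<alpha>|\<close> and after
  \<open>|\<beta>|\<close> edges coincide (\<open>phi_pair_fixes_iff\<close>).

  On the other side, a path is of the form \<open>\<delta>\<close>-part followed by repetitions of a loop with label
  word \<open>\<gamma>\<close> iff its labels begin with \<open>\<delta>\<gamma>\<close> and its tails after \<open>|\<delta>\<gamma>|\<close> and \<open>|\<delta>|\<close> edges coincide
  (\<open>periodic_iff\<close>), while \<open>\<delta>\<gamma>\<delta>\<^sup>-\<^sup>1\<close> and \<open>\<delta>\<gamma>\<^sup>-\<^sup>1\<delta>\<^sup>-\<^sup>1\<close> are the quotient of \<open>\<delta>\<gamma>\<close> by \<open>\<delta>\<close> and its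
  inverse. The two conditions thus have the same shape. From the first one, both \<open>\<alpha>\<close> and \<open>\<beta>\<close>
  are initial words of the labels, so the shorter one serves as \<open>\<delta>\<close> and the longer one is
  \<open>\<delta>\<gamma>\<close>. For the converse, the quotient of \<open>\<delta>\<gamma>\<close> and \<open>\<delta>\<close> need not be reduced: a common suffix
  \<open>\<sigma>\<close> may cancel (\<open>reduced_form_quotient\<close>). The tails known to coincide then start \<open>|\<sigma>|\<close> edges
  too late, but since the labels before them spell \<open>\<sigma>\<close> in both places, the agreement propagates
  backwards by the same determinacy of edges (\<open>tails_agree_backwards\<close>).
\<close>

section \<open>Quotients of positive words in the free group\<close>

lemma formal_inverse_pos_word: "formal_inverse (pos_word \<beta>) = map (\<lambda>b. (b, False)) (rev \<beta>)"
  by (simp add: formal_inverse_def pos_word_def flip_sign_def rev_map comp_def)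

lemma reduced_pos_word: "reduced_word (pos_word \<alpha>)"
  by (simp add: reduced_word_def pos_word_def flip_sign_def)

lemma pos_word_in_carrier: "pos_word \<alpha> \<in> carrier free_group"
  by (simp add: free_group_def reduced_pos_word)

lemma free_group_mult_reduced:
  assumes "reduced_word (u @ v)"
  shows "u \<otimes>\<^bsub>free_group\<^esub> v = u @ v"
proof -
  have "foldr cons_reduce u v = u @ v"
    using assms
  proof (induction u)
    case (Cons x u)
    then have "foldr cons_reduce u v = u @ v"
      by (auto dest: reduced_ConsD)
    with Cons.prems show ?case
      by (cases "u @ v") auto
  qed simp
  then show ?thesis
    by (simp add: free_group_def)
qed

lemma pos_word_append: "pos_word (\<alpha> @ \<beta>) = pos_word \<alpha> \<otimes>\<^bsub>free_group\<^esub> pos_word \<beta>"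
  using reduced_pos_word[of "\<alpha> @ \<beta>"] by (simp add: free_group_mult_reduced pos_word_def)

lemma reduced_form_mult:
  assumes "reduced_form t \<alpha> \<beta>"
  shows "t = pos_word \<alpha> \<otimes>\<^bsub>free_group\<^esub> inv\<^bsub>free_group\<^esub> (pos_word \<beta>)"
  using assms
  by (auto simp: reduced_form_def inv_free_group pos_word_in_carrier free_group_mult_reduced)

lemma reduced_form_inverse:
  assumes "reduced_form t \<alpha> \<beta>"
  shows "reduced_form (inv\<^bsub>free_group\<^esub> t) \<beta> \<alpha>"
proof -
  have "inv\<^bsub>free_group\<^esub> t = formal_inverse t"
    using assms by (intro inv_free_group) (auto simp: reduced_form_def free_group_def)
  moreover have "formal_inverse t = pos_word \<beta> @ formal_inverse (pos_word \<alpha>)"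
    using assms by (simp add: reduced_form_def formal_inverse_def rev_map comp_def)
  ultimately show ?thesis
    using assms reduced_formal_inverse[of t] unfolding reduced_form_def by metis
qed

lemma reduced_form_unique:
  assumes "reduced_form t \<alpha> \<beta>" and "reduced_form t \<alpha>' \<beta>'"
  shows "\<alpha>' = \<alpha>" and "\<beta>' = \<beta>"
proof -
  have *: "\<alpha> = map fst (takeWhile snd t) \<and> \<beta> = rev (map fst (dropWhile snd t))"
    if "reduced_form t \<alpha> \<beta>" for \<alpha> \<beta> :: "'a list"
  proof -
    from that have t: "t = pos_word \<alpha> @ map (\<lambda>b. (b, False)) (rev \<beta>)"
      by (simp add: reduced_form_def formal_inverse_pos_word)
    have "takeWhile snd (map (\<lambda>b. (b, False)) (rev \<beta>)) = []"
      and "dropWhile snd (map (\<lambda>b. (b, False)) (rev \<beta>)) = map (\<lambda>b. (b, False)) (rev \<beta>)"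
      by (cases "rev \<beta>"; simp)+
    moreover have "\<forall>x\<in>set (pos_word \<alpha>). snd x"
      by (auto simp: pos_word_def)
    ultimately have "takeWhile snd t = pos_word \<alpha>"
      and "dropWhile snd t = map (\<lambda>b. (b, False)) (rev \<beta>)"
      unfolding t by (simp_all add: takeWhile_append2 dropWhile_append2)
    then show ?thesis
      by (simp add: pos_word_def comp_def flip: rev_map)
  qed
  from *[OF assms(1)] *[OF assms(2)] show "\<alpha>' = \<alpha>" and "\<beta>' = \<beta>"
    by simp_all
qed

lemma reduced_quotient_iff:
  "reduced_word (pos_word \<alpha> @ formal_inverse (pos_word \<beta>)) \<longleftrightarrow>
     \<alpha> = [] \<or> \<beta> = [] \<or> last \<alpha> \<noteq> last \<beta>"
proof (induction \<alpha>)
  case Nil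
  show ?case
    using reduced_formal_inverse[OF reduced_pos_word] by (simp add: pos_word_def)
next
  case (Cons a \<alpha>)
  show ?case
  proof (cases \<alpha>)
    case Nil
    show ?thesis
    proof (cases \<beta> rule: rev_cases)
      case Nil
      with \<open>\<alpha> = []\<close> show ?thesis
        by (simp add: pos_word_def formal_inverse_def)
    next
      case (snoc \<beta>' b)
      have "reduced_word (formal_inverse (pos_word \<beta>))"
        using reduced_formal_inverse[OF reduced_pos_word] .
      with snoc \<open>\<alpha> = []\<close> show ?thesis
        by (auto simp: formal_inverse_pos_word) (auto simp: pos_word_def flip_sign_def)
    qed
  next
    case (Cons a' \<alpha>')
    with Cons.IH show ?thesis
      by (simp add: pos_word_def flip_sign_def)
  qed
qed

text \<open>
  The only cancellation in \<open>uv\<^sup>-\<^sup>1\<close> is that of common last letters, so what disappears on passing to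
  the reduced form is a common suffix of \<open>u\<close> and \<open>v\<close>.
\<close>

lemma reduced_form_quotient:
  assumes "reduced_form (pos_word u \<otimes>\<^bsub>free_group\<^esub> inv\<^bsub>free_group\<^esub> (pos_word v)) \<alpha> \<beta>"
  obtains \<sigma> where "u = \<alpha> @ \<sigma>" and "v = \<beta> @ \<sigma>"
proof -
  interpret group "free_group :: 'a signed_word monoid"
    by (rule group_free_group)
  note [simp] = pos_word_in_carrier
  have "\<exists>\<sigma>. u = \<alpha> @ \<sigma> \<and> v = \<beta> @ \<sigma>"
    using assms
  proof (induction u arbitrary: v rule: rev_induct)
    case Nil
    have "reduced_form (pos_word [] \<otimes>\<^bsub>free_group\<^esub> inv\<^bsub>free_group\<^esub> (pos_word v)) [] v"
      by (simp add: reduced_form_def inv_free_group free_group_mult_reduced reduced_quotient_iff)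
    from reduced_form_unique[OF this Nil] show ?case
      by simp
  next
    case (snoc a u)
    show ?case
    proof (cases "v \<noteq> [] \<and> last v = a")
      case True
      then obtain v' where v: "v = v' @ [a]"
        by (metis append_butlast_last_id)
      have "pos_word (u @ [a]) \<otimes>\<^bsub>free_group\<^esub> inv\<^bsub>free_group\<^esub> (pos_word v)
          = pos_word u \<otimes>\<^bsub>free_group\<^esub> inv\<^bsub>free_group\<^esub> (pos_word v')"
        by (simp add: v pos_word_append inv_mult_group m_assoc)
          (simp flip: m_assoc)
      with snoc.prems have "\<exists>\<sigma>. u = \<alpha> @ \<sigma> \<and> v' = \<beta> @ \<sigma>"
        by (intro snoc.IH) simp
      with v show ?thesis
        by auto
    next
      case False
      then have "reduced_form (pos_word (u @ [a]) \<otimes>\<^bsub>free_group\<^esub> inv\<^bsub>free_group\<^esub> (pos_word v))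
          (u @ [a]) v"
        by (auto simp: reduced_form_def inv_free_group free_group_mult_reduced reduced_quotient_iff)
      from reduced_form_unique[OF this snoc.prems] show ?thesis
        by simp
    qed
  qed
  with that show thesis
    by blast
qed

text \<open>
  In this form both kinds of conjugates are quotients of two positive words one of which is a prefix
  of the other, to which the description of reduced forms applies.
\<close>

lemma conjugate_eq_quotient:
  "pos_word \<delta> \<otimes>\<^bsub>free_group\<^esub> pos_word \<gamma> \<otimes>\<^bsub>free_group\<^esub> inv\<^bsub>free_group\<^esub> (pos_word \<delta>)
     = pos_word (\<delta> @ \<gamma>) \<otimes>\<^bsub>free_group\<^esub> inv\<^bsub>free_group\<^esub> (pos_word \<delta>)"
  "pos_word \<delta> \<otimes>\<^bsub>free_group\<^esub> inv\<^bsub>free_group\<^esub> (pos_word \<gamma>)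
       \<otimes>\<^bsub>free_group\<^esub> inv\<^bsub>free_group\<^esub> (pos_word \<delta>)
     = pos_word \<delta> \<otimes>\<^bsub>free_group\<^esub> inv\<^bsub>free_group\<^esub> (pos_word (\<delta> @ \<gamma>))"
proof -
  interpret group "free_group :: 'a signed_word monoid"
    by (rule group_free_group)
  show "pos_word \<delta> \<otimes>\<^bsub>free_group\<^esub> pos_word \<gamma> \<otimes>\<^bsub>free_group\<^esub> inv\<^bsub>free_group\<^esub> (pos_word \<delta>)
     = pos_word (\<delta> @ \<gamma>) \<otimes>\<^bsub>free_group\<^esub> inv\<^bsub>free_group\<^esub> (pos_word \<delta>)"
    by (simp add: pos_word_append)
  show "pos_word \<delta> \<otimes>\<^bsub>free_group\<^esub> inv\<^bsub>free_group\<^esub> (pos_word \<gamma>)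
       \<otimes>\<^bsub>free_group\<^esub> inv\<^bsub>free_group\<^esub> (pos_word \<delta>)
     = pos_word \<delta> \<otimes>\<^bsub>free_group\<^esub> inv\<^bsub>free_group\<^esub> (pos_word (\<delta> @ \<gamma>))"
    by (simp add: pos_word_append inv_mult_group m_assoc pos_word_in_carrier)
qed

section \<open>Edges are determined by their label and domain\<close>

text \<open>
  A filter of \<open>I a\<close> is upward closed within \<open>I a\<close>, so it is the trace on \<open>I a\<close> of the filter that
  it generates.
\<close>

lemma edge_eq_label_dom:
  assumes "e \<in> E1 I"
  shows "e = (fst e, edge_dom e \<inter> I (fst e))"
proof -
  from assms obtain a \<eta> where e: "e = (a, \<eta>)" and \<eta>: "filter_in (I a) \<eta>"
    by (auto simp: E1_def ultrafilters_def)
  from \<eta> have "\<eta> = {C. \<exists>A\<in>\<eta>. A \<le> C} \<inter> I a"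
    unfolding filter_in_def by (auto intro: order_refl)
  with e show ?thesis
    by (simp add: edge_dom_def)
qed

text \<open>
  A single recursion equation in place of the case distinction in the definition, displaying the
  vertex that each edge must lead to.
\<close>

lemma edges_into_Cons:
  "edges_into \<theta> I (a # \<alpha>) v =
     (a, (if \<alpha> = [] then v else edge_rng \<theta> (hd (edges_into \<theta> I \<alpha> v))) \<inter> I a)
       # edges_into \<theta> I \<alpha> v"
proof (cases \<alpha>)
  case (Cons b \<beta>)
  have "fst (hd (edges_into \<theta> I (b # \<beta>) v)) = b"
    by (cases \<beta>) (simp_all add: Let_def)
  with Cons show ?thesis
    by (simp add: Let_def edge_rng_def)
qed simp

lemma labels_edges_into [simp]: "map fst (edges_into \<theta> I \<alpha> v) = \<alpha>"
  by (induction \<alpha>) (simp_all add: edges_into_Cons)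

lemma length_edges_into [simp]: "length (edges_into \<theta> I \<alpha> v) = length \<alpha>"
  by (metis labels_edges_into length_map)

section \<open>Infinite paths with coinciding tails\<close>

lemma segment_eq_iff:
  "map g [m..<m + length xs] = xs \<longleftrightarrow> (\<forall>i<length xs. g (m + i) = xs ! i)"
  by (auto simp: list_eq_iff_nth_eq[where ys = xs])

lemmas initial_segment_eq_iff = segment_eq_iff[where m = 0, simplified]

locale infinite_path =
  fixes \<theta> :: "'l \<Rightarrow> 'a::generalized_boolean_algebra \<Rightarrow> 'a"
    and I :: "'l \<Rightarrow> 'a set"
    and f :: "nat \<Rightarrow> ('l, 'a) edge"
  assumes edge: "f i \<in> E1 I"
    and edge_dom_eq: "edge_dom (f i) = edge_rng \<theta> (f (Suc i))"
begin

lemma edge_eq_label_rng: "f i = (fst (f i), edge_rng \<theta> (f (Suc i)) \<inter> I (fst (f i)))"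
  using edge_eq_label_dom[OF edge, of i] by (simp only: edge_dom_eq)

lemma edges_into_eq_segment:
  assumes "m \<le> n"
  shows "edges_into \<theta> I (map (fst \<circ> f) [m..<n]) (edge_rng \<theta> (f n)) = map f [m..<n]"
  using assms
proof (induction rule: inc_induct)
  case (step m)
  let ?\<alpha> = "map (fst \<circ> f) [Suc m..<n]"
  have "(if ?\<alpha> = [] then edge_rng \<theta> (f n)
         else edge_rng \<theta> (hd (edges_into \<theta> I ?\<alpha> (edge_rng \<theta> (f n))))) = edge_rng \<theta> (f (Suc m))"
  proof (cases "Suc m = n")
    case False
    with step.hyps show ?thesis
      unfolding step.IH by (simp add: hd_map)
  qed simp
  with step.hyps have "edges_into \<theta> I (map (fst \<circ> f) [m..<n]) (edge_rng \<theta> (f n))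
      = (fst (f m), edge_rng \<theta> (f (Suc m)) \<inter> I (fst (f m))) # map f [Suc m..<n]"
    by (simp only: upt_conv_Cons list.map comp_apply edges_into_Cons step.IH)
  with step.hyps show ?case
    by (simp only: upt_conv_Cons list.map flip: edge_eq_label_rng)
qed simp

text \<open>
  Since an edge of the path is determined by its label and the next edge, an agreement between two
  tails of the path propagates backwards as long as the labels agree.
\<close>

lemma tails_agree_backwards:
  assumes tails: "\<And>j. j \<ge> n \<Longrightarrow> f (p + j) = f (q + j)"
    and labels: "\<And>j. j < n \<Longrightarrow> fst (f (p + j)) = fst (f (q + j))"
  shows "f (p + j) = f (q + j)"
proof (cases "j \<ge> n")
  case False
  then have "j \<le> n"
    by simp
  then show ?thesis
  proof (induction rule: inc_induct)
    case base
    show ?case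
      by (rule tails) simp
  next
    case (step j)
    then have "fst (f (p + j)) = fst (f (q + j))" and "f (Suc (p + j)) = f (Suc (q + j))"
      using labels[of j] by simp_all
    then show ?case
      using edge_eq_label_rng[of "p + j"] edge_eq_label_rng[of "q + j"] by metis
  qed
qed (rule tails)

lemma vertex_after_eq: "vertex_after \<theta> (Edges (InfW f)) n = edge_rng \<theta> (f n)"
  by (cases n) (simp_all add: vertex_after_def edge_dom_eq)

text \<open>
  Comparing the two paths from position \<open>|\<beta>|\<close> on gives the condition on tails. Its instance at
  \<open>j = 0\<close> says that the inserted edges lead to the vertex in which the first \<open>|\<beta>|\<close> edges of the
  path end, so that for the initial part it is enough to compare labels.
\<close>

lemma phi_pair_fixes_iff:
  "phi_pair \<theta> I \<beta> \<alpha> (Edges (InfW f)) = Edges (InfW f) \<longleftrightarrow>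
     map (fst \<circ> f) [0..<length \<beta>] = \<beta> \<and> (\<forall>j. f (length \<alpha> + j) = f (length \<beta> + j))"
proof -
  let ?es = "edges_into \<theta> I \<beta> (edge_rng \<theta> (f (length \<alpha>)))"
  have "phi_pair \<theta> I \<beta> \<alpha> (Edges (InfW f)) = Edges (InfW (?es \<frown> (\<lambda>i. f (length \<alpha> + i))))"
    by (simp add: phi_pair_def vertex_after_eq)
  moreover have "?es \<frown> (\<lambda>i. f (length \<alpha> + i)) = f \<longleftrightarrow>
      ?es = map f [0..<length \<beta>] \<and> (\<forall>j. f (length \<alpha> + j) = f (length \<beta> + j))" (is "?L \<longleftrightarrow> ?R")
  proof
    assume L: ?L
    have "?es = map f [0..<length \<beta>]"
    proof (rule nth_equalityI)
      show "?es ! i = map f [0..<length \<beta>] ! i" if "i < length ?es" for i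
        using fun_cong[OF L, of i] that by simp
    qed simp
    moreover have "f (length \<alpha> + j) = f (length \<beta> + j)" for j
      using fun_cong[OF L, of "length \<beta> + j"] by simp
    ultimately show ?R
      by blast
  next
    assume R: ?R
    show ?L
    proof
      fix i
      have "f (length \<alpha> + (i - length \<beta>)) = f (length \<beta> + (i - length \<beta>))"
        using R by blast
      then show "(?es \<frown> (\<lambda>i. f (length \<alpha> + i))) i = f i"
        unfolding conjunct1[OF R] by (cases "i < length \<beta>") (simp_all add: conc_def)
    qed
  qed
  moreover have "?es = map f [0..<length \<beta>] \<longleftrightarrow> map (fst \<circ> f) [0..<length \<beta>] = \<beta>"
    if "\<forall>j. f (length \<alpha> + j) = f (length \<beta> + j)"
  proof
    assume "?es = map f [0..<length \<beta>]"
    then have "map fst ?es = map fst (map f [0..<length \<beta>])"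
      by simp
    then show "map (fst \<circ> f) [0..<length \<beta>] = \<beta>"
      by simp
  next
    assume labels: "map (fst \<circ> f) [0..<length \<beta>] = \<beta>"
    from that[rule_format, of 0] have "f (length \<alpha>) = f (length \<beta>)"
      by simp
    with edges_into_eq_segment[of 0 "length \<beta>"] labels show "?es = map f [0..<length \<beta>]"
      by simp
  qed
  ultimately show ?thesis
    by auto
qed

lemma edge_list_eq_segment:
  assumes "map (fst \<circ> f) [m..<m + length \<alpha>] = \<alpha>"
  shows "edge_list \<alpha> (\<lambda>i. path_filter (Edges (InfW f)) (m + i)) = map f [m..<m + length \<alpha>]"
proof (rule nth_equalityI)
  fix i
  assume "i < length (edge_list \<alpha> (\<lambda>i. path_filter (Edges (InfW f)) (m + i)))"
  then have i: "i < length \<alpha>"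
    by (simp add: edge_list_def)
  then have "\<alpha> ! i = fst (f (m + i))"
    by (subst assms[symmetric]) simp
  with i show "edge_list \<alpha> (\<lambda>i. path_filter (Edges (InfW f)) (m + i)) ! i
      = map f [m..<m + length \<alpha>] ! i"
    by (simp add: edge_list_def path_filter_def)
qed (simp add: edge_list_def)

lemma loop_segment:
  assumes "m < n" and "f n = f m"
  shows "loop_at \<theta> I (Edges (FinW (map f [m..<n]))) (edge_rng \<theta> (f m))"
proof -
  have "Edges (FinW (map f [m..<n])) \<in> finite_paths_of_length \<theta> I (n - m)"
    using assms edge by (auto simp: finite_paths_of_length_def edge_dom_eq)
  moreover have "Edges (FinW (map f [m..<n])) \<notin> finite_paths_of_length \<theta> I 0"
    by (auto simp: finite_paths_of_length_def)
  moreover have "edge_dom (last (map f [m..<n])) = edge_rng \<theta> (f m)"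
    using assms edge_dom_eq[of "n - 1"] by (simp add: last_map last_upt)
  ultimately show ?thesis
    using assms by (auto simp: loop_at_def finite_paths_def)
qed

text \<open>
  That the repeated segment is a loop follows from periodicity: its last edge ends where the next
  edge starts, and that edge is the first edge of the segment again.
\<close>

lemma periodic_iff:
  assumes "\<gamma> \<noteq> []"
  defines "\<mu> \<equiv> Edges (InfW f)"
  shows "label_word \<mu> = InfW (\<delta> \<frown> \<gamma>\<^sup>\<omega>) \<and>
      loop_at \<theta> I
        (Edges (FinW (edge_list \<gamma> (\<lambda>i. path_filter \<mu> (length \<delta> + i)))))
        (if \<delta> = [] then path_rng \<theta> \<mu>
         else edge_dom (last \<delta>, path_filter \<mu> (length \<delta> - 1))) \<and>
      \<mu> = Edges (InfW (edge_list \<delta> (path_filter \<mu>) \<frown>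
            (edge_list \<gamma> (\<lambda>i. path_filter \<mu> (length \<delta> + i)))\<^sup>\<omega>)) \<longleftrightarrow>
    map (fst \<circ> f) [0..<length (\<delta> @ \<gamma>)] = \<delta> @ \<gamma> \<and>
      (\<forall>j. f (length (\<delta> @ \<gamma>) + j) = f (length \<delta> + j))"
    (is "?lab \<and> ?loop \<and> ?eq \<longleftrightarrow> ?pre \<and> ?per")
proof
  assume *: "?lab \<and> ?loop \<and> ?eq"
  then have ?lab
    by blast
  then have lab: "fst \<circ> f = \<delta> \<frown> \<gamma>\<^sup>\<omega>"
    by (simp add: \<mu>_def label_word_def comp_def)
  have ?pre
    unfolding lab initial_segment_eq_iff using assms(1)
    by (auto simp: nth_append conc_def iter_def)
  moreover
  have ?per
  proof -
    define D G where "D = edge_list \<delta> (path_filter \<mu>)"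
      and "G = edge_list \<gamma> (\<lambda>i. path_filter \<mu> (length \<delta> + i))"
    have length: "length D = length \<delta>" "length G = length \<gamma>"
      by (simp_all add: D_def G_def edge_list_def)
    with assms(1) have "G \<noteq> []"
      by auto
    from * have "\<mu> = Edges (InfW (D \<frown> G\<^sup>\<omega>))"
      unfolding D_def G_def by blast
    then have f: "f = D \<frown> G\<^sup>\<omega>"
      by (simp add: \<mu>_def)
    have "f (length \<delta> + j) = G ! (j mod length \<gamma>)" for j
      using fun_cong[OF f, of "length \<delta> + j"] \<open>G \<noteq> []\<close> by (simp add: conc_def iter_def length)
    then show ?thesis
      by (simp add: add.assoc)
  qed
  ultimately show "?pre \<and> ?per" ..
next
  assume *: "?pre \<and> ?per"
  let ?d = "length \<delta>" and ?g = "length \<gamma>"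
  have g: "?g > 0"
    using assms(1) by simp
  have pre: "fst (f i) = (\<delta> @ \<gamma>) ! i" if "i < ?d + ?g" for i
    using conjunct1[OF *] that unfolding initial_segment_eq_iff by simp
  have \<delta>: "map (fst \<circ> f) [0..<0 + ?d] = \<delta>" and \<gamma>: "map (fst \<circ> f) [?d..<?d + ?g] = \<gamma>"
    using pre unfolding segment_eq_iff by (simp_all add: nth_append)
  have seg: "edge_list \<delta> (path_filter \<mu>) = map f [0..<?d]"
      "edge_list \<gamma> (\<lambda>i. path_filter \<mu> (?d + i)) = map f [?d..<?d + ?g]"
    using edge_list_eq_segment[OF \<delta>] edge_list_eq_segment[OF \<gamma>] by (simp_all add: \<mu>_def)
  have per: "f (?d + j) = f (?d + j mod ?g)" for j
  proof (induction j rule: less_induct)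
    case (less j)
    show ?case
    proof (cases "j < ?g")
      case False
      then obtain k where j: "j = ?g + k"
        by (metis le_add_diff_inverse not_less)
      with * have "f (?d + j) = f (?d + k)"
        by (metis add.assoc length_append)
      also have "\<dots> = f (?d + k mod ?g)"
        using g by (intro less.IH) (simp add: j)
      finally show ?thesis
        by (simp add: j)
    qed simp
  qed
  have f: "f = map f [0..<?d] \<frown> (map f [?d..<?d + ?g])\<^sup>\<omega>"
  proof
    fix i
    show "f i = (map f [0..<?d] \<frown> (map f [?d..<?d + ?g])\<^sup>\<omega>) i"
      using per[of "i - ?d"] g by (cases "i < ?d") (simp_all add: conc_def iter_def)
  qed
  have ?eq
    unfolding seg unfolding \<mu>_def by (rule arg_cong[OF f])
  moreover have ?lab
  proof -
    have "fst (f i) = (\<delta> \<frown> \<gamma>\<^sup>\<omega>) i" for i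
    proof (cases "i < ?d")
      case False
      then have "fst (f i) = fst (f (?d + (i - ?d) mod ?g))"
        using per[of "i - ?d"] by simp
      also have "\<dots> = (\<delta> @ \<gamma>) ! (?d + (i - ?d) mod ?g)"
        using g by (intro pre) simp
      finally show ?thesis
        using False assms(1) by (simp add: conc_def iter_def)
    qed (simp add: pre conc_def nth_append)
    then show ?thesis
      by (auto simp: label_word_def \<mu>_def)
  qed
  moreover have ?loop
  proof -
    have "(if \<delta> = [] then path_rng \<theta> \<mu>
         else edge_dom (last \<delta>, path_filter \<mu> (length \<delta> - 1))) = edge_rng \<theta> (f ?d)"
    proof (cases "\<delta> = []")
      case False
      have "?d - 1 < ?d + ?g"
        using g by linarith
      from pre[OF this] False have "fst (f (?d - 1)) = last \<delta>"
        by (simp add: nth_append last_conv_nth)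
      then have "(last \<delta>, path_filter \<mu> (?d - 1)) = f (?d - 1)"
        by (simp add: \<mu>_def path_filter_def prod_eq_iff)
      with False edge_dom_eq[of "?d - 1"] show ?thesis
        by simp
    qed (simp add: \<mu>_def)
    moreover have "f (?d + ?g) = f ?d"
      using conjunct2[OF *, rule_format, of 0] by simp
    ultimately show ?thesis
      unfolding seg using loop_segment[of ?d "?d + ?g"] g by simp
  qed
  ultimately show "?lab \<and> ?loop \<and> ?eq"
    by blast
qed

end

section \<open>Isotropy\<close>

lemma phi_inverse_eq_phi_pair:
  assumes "t \<in> carrier free_group" and "t \<noteq> \<one>\<^bsub>free_group\<^esub>" and "\<mu> \<in> U_dom \<theta> I t"
    and "reduced_form t \<alpha> \<beta>"
  shows "phi \<theta> I (inv\<^bsub>free_group\<^esub> t) \<mu> = phi_pair \<theta> I \<beta> \<alpha> \<mu>"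
proof -
  interpret group "free_group :: 'a signed_word monoid"
    by (rule group_free_group)
  note inverse = reduced_form_inverse[OF assms(4)]
  have "(THE (\<alpha>, \<beta>). reduced_form (inv\<^bsub>free_group\<^esub> t) \<alpha> \<beta>) = (\<beta>, \<alpha>)"
    using inverse by (intro the_equality) (auto dest: reduced_form_unique[OF inverse])
  moreover have "inv\<^bsub>free_group\<^esub> t \<noteq> \<one>\<^bsub>free_group\<^esub>"
    using assms(1,2) by (simp add: inv_eq_1_iff)
  ultimately show ?thesis
    using assms(1,3) by (simp add: phi_def)
qed

text \<open>
  Exchanging an initial segment of a finite path changes the length by \<open>|\<beta>| - |\<alpha>|\<close>; if the result
  is the same path, then both \<open>\<alpha>\<close> and \<open>\<beta>\<close> are its initial word of that common length.
\<close>

lemma fixed_finite_path_words_eq: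
  assumes "path_edges \<mu> = FinW es"
    and "word_take (length \<alpha>) (label_word \<mu>) = \<alpha>"
    and "phi_pair \<theta> I \<beta> \<alpha> \<mu> = \<mu>"
  shows "\<alpha> = \<beta>"
proof -
  let ?es = "edges_into \<theta> I \<beta> (vertex_after \<theta> \<mu> (length \<alpha>))"
  have \<alpha>: "take (length \<alpha>) (map fst es) = \<alpha>"
    using assms(1,2) by (simp add: label_word_def)
  have es: "?es @ drop (length \<alpha>) es = es"
    using assms(1,3) by (cases \<mu>) (auto simp: phi_pair_def Let_def split: if_splits)
  have "length \<alpha> \<le> length es"
    using arg_cong[OF \<alpha>, of length] by simp
  moreover have "length \<beta> + (length es - length \<alpha>) = length es"
    using arg_cong[OF es, of length] by simp
  ultimately have "length \<alpha> = length \<beta>"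
    by simp
  moreover have "map fst es = \<beta> @ map fst (drop (length \<alpha>) es)"
    by (subst es[symmetric]) (simp only: map_append labels_edges_into)
  ultimately show ?thesis
    using \<alpha> by simp
qed

theorem lemma4p4:
  fixes \<theta> :: "'l \<Rightarrow> 'a::generalized_boolean_algebra \<Rightarrow> 'a"
    and I :: "'l \<Rightarrow> 'a set"
    and t :: "'l signed_word"
    and \<mu> :: "('l, 'a) path"
  assumes "generalized_BDS \<theta> I"
    and "(t, \<mu>) \<in> arrows (transformation_groupoid \<theta> I)"
    and "t \<noteq> \<one>\<^bsub>free_group\<^esub>"
  shows "(t, \<mu>) \<in> isotropy (transformation_groupoid \<theta> I) \<longleftrightarrow>
    (\<exists>\<delta> \<gamma>. \<gamma> \<noteq> [] \<and>
      (t = pos_word \<delta> \<otimes>\<^bsub>free_group\<^esub> pos_word \<gamma> \<otimes>\<^bsub>free_group\<^esub> inv\<^bsub>free_group\<^esub> (pos_word \<delta>) \<or>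
       t = pos_word \<delta> \<otimes>\<^bsub>free_group\<^esub> inv\<^bsub>free_group\<^esub> (pos_word \<gamma>)
             \<otimes>\<^bsub>free_group\<^esub> inv\<^bsub>free_group\<^esub> (pos_word \<delta>)) \<and>
      label_word \<mu> = InfW (\<delta> \<frown> \<gamma>\<^sup>\<omega>) \<and>
      loop_at \<theta> I
        (Edges (FinW (edge_list \<gamma> (\<lambda>i. path_filter \<mu> (length \<delta> + i)))))
        (if \<delta> = [] then path_rng \<theta> \<mu>
         else edge_dom (last \<delta>, path_filter \<mu> (length \<delta> - 1))) \<and>
      \<mu> = Edges (InfW (edge_list \<delta> (path_filter \<mu>) \<frown>
            (edge_list \<gamma> (\<lambda>i. path_filter \<mu> (length \<delta> + i)))\<^sup>\<omega>)))"
    (is "_ \<longleftrightarrow> ?periodic")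
proof -
  have t: "t \<in> carrier free_group" and \<mu>: "\<mu> \<in> boundary_paths \<theta> I" and U: "\<mu> \<in> U_dom \<theta> I t"
    using assms(2) by (simp_all add: transformation_groupoid_def)
  from U assms(3) obtain \<alpha> \<beta> where \<alpha>\<beta>: "reduced_form t \<alpha> \<beta>" and pair: "\<mu> \<in> U_pair \<theta> I \<alpha> \<beta>"
    unfolding U_dom_def by auto
  have \<alpha>: "word_take (length \<alpha>) (label_word \<mu>) = \<alpha>"
    using pair by (cases "label_word \<mu>") (auto simp: U_pair_def split: if_splits)
  have neq: "\<alpha> \<noteq> \<beta>"
  proof
    assume "\<alpha> = \<beta>"
    with \<alpha>\<beta> have "\<alpha> = []" "\<beta> = []"
      by (auto simp: reduced_form_def reduced_quotient_iff)
    with \<alpha>\<beta> assms(3) show False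
      by (simp add: reduced_form_def pos_word_def formal_inverse_def free_group_def)
  qed
  have iso: "(t, \<mu>) \<in> isotropy (transformation_groupoid \<theta> I) \<longleftrightarrow> phi_pair \<theta> I \<beta> \<alpha> \<mu> = \<mu>"
    using assms(2) phi_inverse_eq_phi_pair[OF t assms(3) U \<alpha>\<beta>]
    by (simp add: isotropy_def) (simp add: transformation_groupoid_def)
  show ?thesis
  proof (cases "path_edges \<mu>")
    case (FinW es)
    then have "phi_pair \<theta> I \<beta> \<alpha> \<mu> \<noteq> \<mu>"
      using fixed_finite_path_words_eq[OF FinW \<alpha>] neq by blast
    moreover have "label_word \<mu> \<noteq> InfW w" for w
      using FinW by (simp add: label_word_def)
    ultimately show ?thesis
      using iso by blast
  next
    case (InfW f)
    then have \<mu>f: "\<mu> = Edges (InfW f)"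
      by (cases \<mu>) auto
    with \<mu> have "\<mu> \<in> infinite_paths \<theta> I"
      by (auto simp: boundary_paths_def finite_paths_def finite_paths_of_length_def split: if_splits)
    then interpret infinite_path \<theta> I f
      by unfold_locales (auto simp: \<mu>f infinite_paths_def)
    have pre_\<alpha>: "map (fst \<circ> f) [0..<length \<alpha>] = \<alpha>"
      using \<alpha> by (simp add: \<mu>f label_word_def comp_def)
    note periodic = periodic_iff[folded \<mu>f]
    \<comment> \<open>Both sides of the equivalence become conditions on labels and coinciding tails.\<close>
    have "?periodic \<longleftrightarrow> (\<exists>\<delta> \<gamma>. \<gamma> \<noteq> [] \<and>
        (t = pos_word (\<delta> @ \<gamma>) \<otimes>\<^bsub>free_group\<^esub> inv\<^bsub>free_group\<^esub> (pos_word \<delta>) \<or>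
         t = pos_word \<delta> \<otimes>\<^bsub>free_group\<^esub> inv\<^bsub>free_group\<^esub> (pos_word (\<delta> @ \<gamma>))) \<and>
        map (fst \<circ> f) [0..<length (\<delta> @ \<gamma>)] = \<delta> @ \<gamma> \<and>
        (\<forall>j. f (length (\<delta> @ \<gamma>) + j) = f (length \<delta> + j)))" (is "_ \<longleftrightarrow> ?quotient")
      unfolding conjugate_eq_quotient
      by (rule ex_cong1, rule ex_cong1, rule conj_cong[OF refl], rule conj_cong[OF refl],
          rule periodic)
    also have "?quotient \<longleftrightarrow> phi_pair \<theta> I \<beta> \<alpha> \<mu> = \<mu>"
    proof
      assume "phi_pair \<theta> I \<beta> \<alpha> \<mu> = \<mu>"
      then have pre_\<beta>: "map (fst \<circ> f) [0..<length \<beta>] = \<beta>"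
        and per: "\<forall>j. f (length \<alpha> + j) = f (length \<beta> + j)"
        unfolding \<mu>f phi_pair_fixes_iff by auto
      have prefix: "\<exists>\<gamma>. \<gamma> \<noteq> [] \<and> v = u @ \<gamma>"
        if "map (fst \<circ> f) [0..<length u] = u" "map (fst \<circ> f) [0..<length v] = v"
          "length u \<le> length v" "u \<noteq> v" for u v
      proof -
        have "take (length u) v = u"
          by (metis that(1,2,3) take_map take_upt add_0)
        with that(4) show ?thesis
          by (metis append_take_drop_id append_Nil2)
      qed
      show ?quotient
      proof (cases "length \<beta> \<le> length \<alpha>")
        case True
        then obtain \<gamma> where \<gamma>: "\<gamma> \<noteq> []" "\<alpha> = \<beta> @ \<gamma>"
          using prefix[OF pre_\<beta> pre_\<alpha>] neq by auto
        show ?thesis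
          by (rule exI[of _ \<beta>], rule exI[of _ \<gamma>])
            (use \<gamma> pre_\<alpha> per reduced_form_mult[OF \<alpha>\<beta>] in simp)
      next
        case False
        then obtain \<gamma> where \<gamma>: "\<gamma> \<noteq> []" "\<beta> = \<alpha> @ \<gamma>"
          using prefix[OF pre_\<alpha> pre_\<beta>] neq by auto
        show ?thesis
          by (rule exI[of _ \<alpha>], rule exI[of _ \<gamma>])
            (use \<gamma> pre_\<beta> per reduced_form_mult[OF \<alpha>\<beta>] in simp)
      qed
    next
      assume ?quotient
      then obtain \<delta> \<gamma> where
        t_eq: "t = pos_word (\<delta> @ \<gamma>) \<otimes>\<^bsub>free_group\<^esub> inv\<^bsub>free_group\<^esub> (pos_word \<delta>) \<or>
          t = pos_word \<delta> \<otimes>\<^bsub>free_group\<^esub> inv\<^bsub>free_group\<^esub> (pos_word (\<delta> @ \<gamma>))"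
        and pre: "map (fst \<circ> f) [0..<length (\<delta> @ \<gamma>)] = \<delta> @ \<gamma>"
        and per: "\<forall>j. f (length (\<delta> @ \<gamma>) + j) = f (length \<delta> + j)"
        by blast
      have lab: "fst (f i) = (\<delta> @ \<gamma>) ! i" if "i < length (\<delta> @ \<gamma>)" for i
        using pre that unfolding initial_segment_eq_iff by simp
      \<comment> \<open>Cancelling a common suffix of \<open>\<delta>\<gamma>\<close> and \<open>\<delta>\<close> keeps both the labels and the coincidence of
        tails. Here \<open>\<kappa>\<close> and \<open>\<rho>\<close> are \<open>\<alpha>\<close> and \<open>\<beta>\<close> in an order that depends on which of the two
        conjugates \<open>t\<close> is.\<close>
      have key: "map (fst \<circ> f) [0..<length \<kappa>] = \<kappa> \<and> map (fst \<circ> f) [0..<length \<rho>] = \<rho> \<and>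
          (\<forall>j. f (length \<kappa> + j) = f (length \<rho> + j))"
        if \<sigma>: "\<delta> @ \<gamma> = \<kappa> @ \<sigma>" "\<delta> = \<rho> @ \<sigma>" for \<kappa> \<rho> \<sigma>
      proof (intro conjI allI)
        have lab': "fst (f i) = (\<kappa> @ \<sigma>) ! i" if "i < length (\<kappa> @ \<sigma>)" for i
          using lab that \<sigma>(1) by simp
        have lab'': "fst (f i) = (\<rho> @ \<sigma>) ! i" if "i < length (\<rho> @ \<sigma>)" for i
          using lab[of i] that unfolding \<sigma>(2)[symmetric] by (simp add: nth_append)
        show "map (fst \<circ> f) [0..<length \<kappa>] = \<kappa>" "map (fst \<circ> f) [0..<length \<rho>] = \<rho>"
          using lab' lab'' unfolding initial_segment_eq_iff by (simp_all add: nth_append)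
        show "f (length \<kappa> + j) = f (length \<rho> + j)" for j
        proof (rule tails_agree_backwards[of "length \<sigma>"])
          show "f (length \<kappa> + j) = f (length \<rho> + j)" if "j \<ge> length \<sigma>" for j
          proof -
            from \<sigma> that have "length \<kappa> + j = length (\<delta> @ \<gamma>) + (j - length \<sigma>)"
              and "length \<rho> + j = length \<delta> + (j - length \<sigma>)"
              by simp_all
            with per show ?thesis
              by metis
          qed
          show "fst (f (length \<kappa> + j)) = fst (f (length \<rho> + j))" if "j < length \<sigma>" for j
            using lab'[of "length \<kappa> + j"] lab''[of "length \<rho> + j"] that by simp
        qed
      qed
      have "map (fst \<circ> f) [0..<length \<beta>] = \<beta> \<and> (\<forall>j. f (length \<alpha> + j) = f (length \<beta> + j))"
        using t_eq
      proof
        assume "t = pos_word (\<delta> @ \<gamma>) \<otimes>\<^bsub>free_group\<^esub> inv\<^bsub>free_group\<^esub> (pos_word \<delta>)"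
        with \<alpha>\<beta> obtain \<sigma> where "\<delta> @ \<gamma> = \<alpha> @ \<sigma>" "\<delta> = \<beta> @ \<sigma>"
          using reduced_form_quotient by blast
        from key[OF this] show ?thesis
          by simp
      next
        assume "t = pos_word \<delta> \<otimes>\<^bsub>free_group\<^esub> inv\<^bsub>free_group\<^esub> (pos_word (\<delta> @ \<gamma>))"
        with \<alpha>\<beta> obtain \<sigma> where "\<delta> = \<alpha> @ \<sigma>" "\<delta> @ \<gamma> = \<beta> @ \<sigma>"
          using reduced_form_quotient by blast
        from key[OF this(2,1)] show ?thesis
          by simp
      qed
      then show "phi_pair \<theta> I \<beta> \<alpha> \<mu> = \<mu>"
        unfolding \<mu>f phi_pair_fixes_iff .
    qed
    finally show ?thesis
      using iso by simp
  qed
qed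

end
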